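(* There are proper non-connected smooth loops $L_\Xi=L_{A,B,\Gamma_0,\delta}$ of positive dimension (for suitable $n$, a Lie subgroup $\Gamma_0$ of $GL(n,\mathbb R)$ of positive dimension, an endomorphism $\delta$ of $\Gamma_0$, and $A,B\in GL(n,\mathbb R)$ such that no matrix $M^{-1}B^{-1}M^{\delta}A$, $M\in\Gamma_0$, has eigenvalue $1$) having Lie algebras as their Akivis algebras, i.e. such that both sides of the Akivis identity in the Akivis algebra of $L_\Xi$ vanish identically, so that its commutator map $[.,.]$ is a Lie bracket.
   Context: The loop $L_\Xi=L_{A,B,\Gamma_0,\delta}$ is realized on $\mathbb R^n\times\Gamma_0$ with multiplication $$(u_1,M_1)\ast(u_2,M_2)=\Big(u_1+[B-(M_1M_2)^{\delta}A(M_1M_2)^{-1}]^{-1}M_1^{\delta}(B-M_2^{\delta}AM_2^{-1})u_2,\ M_1M_2\Big)$$ and identity $(0,I)$. In a loop, $b/a$ denotes the unique $x$ with $x\ast a=b$. A loop is proper if it is not a group, and smooth if it is a $\mathcal C^\infty$-manifold with differentiable multiplication and differentiable left and right divisions. An Akivis algebra $(\mathfrak a,[.,.],\langle.,.,.\rangle)$ is a real vector space with a bilinear skew-symmetric map $[.,.]$ and a trilinear map $\langle.,.,.\rangle$ satisfying the Akivis identity $$[[x,y],z]+[[z,x],y]+[[y,z],x]=\langle x,y,z\rangle+\langle y,z,x\rangle+\langle z,x,y\rangle-\langle z,y,x\rangle-\langle x,z,y\rangle-\langle y,x,z\rangle .$$ The Akivis algebra of $L_\Xi$ is realized on $\mathbb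 R^n\oplus\mathfrak m$, $\mathfrak m$ the Lie algebra of $\Gamma_0$. Put $X_i(t)=(tx_i,\exp tm_i)$; then $[(x_1,m_1),(x_2,m_2)]=\lim_{t\to0}\frac1{t^2}\big((X_1\ast X_2)/(X_2\ast X_1)\big)$ and $\langle(x_1,m_1),(x_2,m_2),(x_3,m_3)\rangle=\lim_{t\to0}\frac1{t^3}\big(((X_1\ast X_2)\ast X_3)/(X_1\ast(X_2\ast X_3))\big)$, where elements near the identity are expressed in the coordinates $(x,\exp m)\leftrightarrow(x,m)$. *)

theory Defs
  imports
    "HOL-Analysis.Analysis"
    "Jordan_Normal_Form.Char_Poly"
    "Jordan_Normal_Form.VS_Connect"
begin

unbundle no vec_syntax

section \<open>Smooth manifolds\<close>

text \<open>
  The dimension has to vary inside formulas, so the model space of dimension \<open>d\<close> is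
  \<^term>\<open>Euclidean_space d\<close>, the sequences that vanish from index \<open>d\<close> on.
\<close>

definition has_partial :: "nat \<Rightarrow> ((nat \<Rightarrow> real) \<Rightarrow> real) \<Rightarrow> (nat \<Rightarrow> real) \<Rightarrow> bool" where
  "has_partial j f x \<longleftrightarrow> (\<lambda>s. f (x(j := s))) differentiable (at (x j))"

definition partial_deriv :: "nat \<Rightarrow> ((nat \<Rightarrow> real) \<Rightarrow> real) \<Rightarrow> (nat \<Rightarrow> real) \<Rightarrow> real" where
  "partial_deriv j f x = deriv (\<lambda>s. f (x(j := s))) (x j)"

text \<open>\<open>U\<close> is meant to be open in \<^term>\<open>Euclidean_space d\<close>.\<close>

primrec C_k_on :: "nat \<Rightarrow> nat \<Rightarrow> (nat \<Rightarrow> real) set \<Rightarrow> ((nat \<Rightarrow> real) \<Rightarrow> real) \<Rightarrow> bool" where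
  "C_k_on d 0 U f \<longleftrightarrow> continuous_map (subtopology (Euclidean_space d) U) euclideanreal f"
| "C_k_on d (Suc k) U f \<longleftrightarrow>
     continuous_map (subtopology (Euclidean_space d) U) euclideanreal f \<and>
     (\<forall>j<d. (\<forall>x\<in>U. has_partial j f x) \<and> C_k_on d k U (partial_deriv j f))"

definition C_infinity_on :: "nat \<Rightarrow> (nat \<Rightarrow> real) set \<Rightarrow> ((nat \<Rightarrow> real) \<Rightarrow> real) \<Rightarrow> bool" where
  "C_infinity_on d U f \<longleftrightarrow> (\<forall>k. C_k_on d k U f)"

type_synonym 'a chart = "'a set \<times> ('a \<Rightarrow> nat \<Rightarrow> real)"

record 'a manifold =
  mtop :: "'a topology"
  mdim :: nat
  atlas :: "'a chart set"

definition is_chart :: "'a topology \<Rightarrow> nat \<Rightarrow> 'a chart \<Rightarrow> bool" where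
  "is_chart T d = (\<lambda>(U, \<phi>).
     openin T U \<and> openin (Euclidean_space d) (\<phi> ` U) \<and>
     homeomorphic_map (subtopology T U) (subtopology (Euclidean_space d) (\<phi> ` U)) \<phi>)"

definition local_rep :: "'a chart \<Rightarrow> 'b chart \<Rightarrow> ('a \<Rightarrow> 'b) \<Rightarrow> (nat \<Rightarrow> real) \<Rightarrow> (nat \<Rightarrow> real)" where
  "local_rep c c' f x = snd c' (f (inv_into (fst c) (snd c) x))"

text \<open>The atlas is not required to be maximal.\<close>

definition smooth_manifold :: "'a manifold \<Rightarrow> bool" where
  "smooth_manifold M \<longleftrightarrow>
     Hausdorff_space (mtop M) \<and> second_countable (mtop M) \<and>
     (\<forall>c\<in>atlas M. is_chart (mtop M) (mdim M) c) \<and>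
     \<Union>(fst ` atlas M) = topspace (mtop M) \<and>
     (\<forall>c\<in>atlas M. \<forall>c'\<in>atlas M. \<forall>i<mdim M.
        C_infinity_on (mdim M) (snd c ` (fst c \<inter> fst c')) (\<lambda>x. local_rep c c' id x i))"

definition smooth_map :: "'a manifold \<Rightarrow> 'b manifold \<Rightarrow> ('a \<Rightarrow> 'b) \<Rightarrow> bool" where
  "smooth_map M N f \<longleftrightarrow>
     continuous_map (mtop M) (mtop N) f \<and>
     (\<forall>c\<in>atlas M. \<forall>c'\<in>atlas N. \<forall>i<mdim N.
        C_infinity_on (mdim M) (snd c ` (fst c \<inter> f -` fst c')) (\<lambda>x. local_rep c c' f x i))"

text \<open>An immersion is a smooth map whose Jacobian matrices in charts are all injective.\<close>

definition immersion :: "'a manifold \<Rightarrow> 'b manifold \<Rightarrow> ('a \<Rightarrow> 'b) \<Rightarrow> bool" where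
  "immersion M N f \<longleftrightarrow>
     smooth_map M N f \<and>
     (\<forall>c\<in>atlas M. \<forall>c'\<in>atlas N. \<forall>p \<in> fst c \<inter> f -` fst c'. \<forall>v :: nat \<Rightarrow> real.
        (\<forall>i<mdim N. (\<Sum>j<mdim M. partial_deriv j (\<lambda>x. local_rep c c' f x i) (snd c p) * v j) = 0)
        \<longrightarrow> (\<forall>j<mdim M. v j = 0))"

definition prod_chart :: "nat \<Rightarrow> 'a chart \<Rightarrow> 'b chart \<Rightarrow> ('a \<times> 'b) chart" where
  "prod_chart d c c' =
     (fst c \<times> fst c', \<lambda>(p, q) i. if i < d then snd c p i else snd c' q (i - d))"

definition prod_manifold :: "'a manifold \<Rightarrow> 'b manifold \<Rightarrow> ('a \<times> 'b) manifold" where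
  "prod_manifold M N =
     \<lparr> mtop = prod_topology (mtop M) (mtop N),
       mdim = mdim M + mdim N,
       atlas = {prod_chart (mdim M) c c' | c c'. c \<in> atlas M \<and> c' \<in> atlas N} \<rparr>"

section \<open>The Lie group GL(n,R) and its Lie subgroups\<close>

definition GL :: "nat \<Rightarrow> real mat monoid" where
  "GL n = units_of (ring_mat TYPE(real) n ())"

definition vec_coords :: "nat \<Rightarrow> real vec \<Rightarrow> nat \<Rightarrow> real" where
  "vec_coords n v = (\<lambda>i. if i < n then v $ i else 0)"

definition mat_coords :: "nat \<Rightarrow> real mat \<Rightarrow> nat \<Rightarrow> real" where
  "mat_coords n X = (\<lambda>k. if k < n * n then X $$ (k div n, k mod n) else 0)"

definition vec_manifold :: "nat \<Rightarrow> real vec manifold" where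
  "vec_manifold n =
     \<lparr> mtop = pullback_topology (carrier_vec n) (vec_coords n) (Euclidean_space n),
       mdim = n,
       atlas = {(carrier_vec n, vec_coords n)} \<rparr>"

definition GL_manifold :: "nat \<Rightarrow> real mat manifold" where
  "GL_manifold n =
     \<lparr> mtop = pullback_topology (carrier (GL n)) (mat_coords n) (Euclidean_space (n * n)),
       mdim = n * n,
       atlas = {(carrier (GL n), mat_coords n)} \<rparr>"

definition lie_group :: "('a, 'b) monoid_scheme \<Rightarrow> 'a manifold \<Rightarrow> bool" where
  "lie_group G M \<longleftrightarrow>
     group G \<and> smooth_manifold M \<and> topspace (mtop M) = carrier G \<and>
     smooth_map (prod_manifold M M) M (\<lambda>(x, y). x \<otimes>\<^bsub>G\<^esub> y) \<and>
     smooth_map M M (\<lambda>x. inv\<^bsub>G\<^esub> x)"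

text \<open>
  Lie subgroups are immersed: the manifold structure \<open>M\<close> is part of the data, and its topology
  may be finer than the one induced from GL(n,R).
\<close>

definition lie_subgroup_GL :: "nat \<Rightarrow> real mat set \<Rightarrow> real mat manifold \<Rightarrow> bool" where
  "lie_subgroup_GL n \<Gamma> M \<longleftrightarrow>
     subgroup \<Gamma> (GL n) \<and> lie_group (GL n \<lparr>carrier := \<Gamma>\<rparr>) M \<and>
     immersion M (GL_manifold n) (\<lambda>X. X)"

definition mat_exp :: "real mat \<Rightarrow> real mat" where
  "mat_exp X = mat (dim_row X) (dim_row X) (\<lambda>(i, j). \<Sum>k. (X ^\<^sub>m k) $$ (i, j) / fact k)"

text \<open>
  Lie subgroups are second countable here, so the set below is the image in the matrices of the
  tangent space of \<open>\<Gamma>\<close> at the identity, also when \<open>\<Gamma>\<close> is not closed.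
\<close>

definition lie_algebra_of :: "nat \<Rightarrow> real mat set \<Rightarrow> real mat set" where
  "lie_algebra_of n \<Gamma> = {X \<in> carrier_mat n n. \<forall>t::real. mat_exp (t \<cdot>\<^sub>m X) \<in> \<Gamma>}"

section \<open>Loops\<close>

locale loop =
  fixes L :: "('a, 'b) monoid_scheme" (structure)
  assumes mult_closed: "\<lbrakk>a \<in> carrier L; b \<in> carrier L\<rbrakk> \<Longrightarrow> a \<otimes> b \<in> carrier L"
    and one_closed: "\<one> \<in> carrier L"
    and left_one: "a \<in> carrier L \<Longrightarrow> \<one> \<otimes> a = a"
    and right_one: "a \<in> carrier L \<Longrightarrow> a \<otimes> \<one> = a"
    and left_division:
      "\<lbrakk>a \<in> carrier L; b \<in> carrier L\<rbrakk> \<Longrightarrow> \<exists>!x. x \<in> carrier L \<and> a \<otimes> x = b"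
    and right_division:
      "\<lbrakk>a \<in> carrier L; b \<in> carrier L\<rbrakk> \<Longrightarrow> \<exists>!x. x \<in> carrier L \<and> x \<otimes> a = b"

text \<open>\<open>ldiv L a b\<close> is \<open>a \ b\<close> and \<open>rdiv L b a\<close> is \<open>b / a\<close>.\<close>

definition ldiv :: "('a, 'b) monoid_scheme \<Rightarrow> 'a \<Rightarrow> 'a \<Rightarrow> 'a" where
  "ldiv L a b = (THE x. x \<in> carrier L \<and> a \<otimes>\<^bsub>L\<^esub> x = b)"

definition rdiv :: "('a, 'b) monoid_scheme \<Rightarrow> 'a \<Rightarrow> 'a \<Rightarrow> 'a" where
  "rdiv L b a = (THE x. x \<in> carrier L \<and> x \<otimes>\<^bsub>L\<^esub> a = b)"

definition proper_loop :: "('a, 'b) monoid_scheme \<Rightarrow> bool" where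
  "proper_loop L \<longleftrightarrow> loop L \<and> \<not> group L"

definition smooth_loop :: "('a, 'b) monoid_scheme \<Rightarrow> 'a manifold \<Rightarrow> bool" where
  "smooth_loop L M \<longleftrightarrow>
     loop L \<and> smooth_manifold M \<and> topspace (mtop M) = carrier L \<and>
     smooth_map (prod_manifold M M) M (\<lambda>(a, b). a \<otimes>\<^bsub>L\<^esub> b) \<and>
     smooth_map (prod_manifold M M) M (\<lambda>(a, b). ldiv L a b) \<and>
     smooth_map (prod_manifold M M) M (\<lambda>(b, a). rdiv L b a)"

text \<open>
  \<open>Xi_diff n A B \<delta> M\<close> is \<open>B - M\<^sup>\<delta> A M\<^sup>-\<^sup>1\<close>. It is invertible exactly when \<open>M\<^sup>-\<^sup>1 B\<^sup>-\<^sup>1 M\<^sup>\<delta> A\<close>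
  does not have the eigenvalue 1.
\<close>

definition Xi_diff :: "nat \<Rightarrow> real mat \<Rightarrow> real mat \<Rightarrow> (real mat \<Rightarrow> real mat) \<Rightarrow> real mat \<Rightarrow> real mat" where
  "Xi_diff n A B \<delta> M = B - \<delta> M * A * inv\<^bsub>GL n\<^esub> M"

definition L_Xi ::
  "nat \<Rightarrow> real mat \<Rightarrow> real mat \<Rightarrow> real mat set \<Rightarrow> (real mat \<Rightarrow> real mat) \<Rightarrow> (real vec \<times> real mat) monoid"
where
  "L_Xi n A B \<Gamma> \<delta> =
     \<lparr> carrier = carrier_vec n \<times> \<Gamma>,
       mult = (\<lambda>(u\<^sub>1, M\<^sub>1) (u\<^sub>2, M\<^sub>2).
         (u\<^sub>1 + (inv\<^bsub>GL n\<^esub> (Xi_diff n A B \<delta> (M\<^sub>1 * M\<^sub>2)) * \<delta> M\<^sub>1 * Xi_diff n A B \<delta> M\<^sub>2) *\<^sub>v u\<^sub>2,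
          M\<^sub>1 * M\<^sub>2)),
       one = (0\<^sub>v n, 1\<^sub>m n) \<rparr>"

section \<open>Akivis algebras and Lie algebras\<close>

definition bilinear_on :: "(real, 'v) module \<Rightarrow> ('v \<Rightarrow> 'v \<Rightarrow> 'v) \<Rightarrow> bool" where
  "bilinear_on V f \<longleftrightarrow>
     (\<forall>x\<in>carrier V. (\<lambda>y. f x y) \<in> module_hom class_ring V V) \<and>
     (\<forall>y\<in>carrier V. (\<lambda>x. f x y) \<in> module_hom class_ring V V)"

definition trilinear_on :: "(real, 'v) module \<Rightarrow> ('v \<Rightarrow> 'v \<Rightarrow> 'v \<Rightarrow> 'v) \<Rightarrow> bool" where
  "trilinear_on V f \<longleftrightarrow>
     (\<forall>x\<in>carrier V. \<forall>y\<in>carrier V. (\<lambda>z. f x y z) \<in> module_hom class_ring V V) \<and>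
     (\<forall>x\<in>carrier V. \<forall>z\<in>carrier V. (\<lambda>y. f x y z) \<in> module_hom class_ring V V) \<and>
     (\<forall>y\<in>carrier V. \<forall>z\<in>carrier V. (\<lambda>x. f x y z) \<in> module_hom class_ring V V)"

definition skew_on :: "(real, 'v) module \<Rightarrow> ('v \<Rightarrow> 'v \<Rightarrow> 'v) \<Rightarrow> bool" where
  "skew_on V br \<longleftrightarrow> (\<forall>x\<in>carrier V. \<forall>y\<in>carrier V. br x y = \<ominus>\<^bsub>V\<^esub> br y x)"

definition jacobi_side :: "(real, 'v) module \<Rightarrow> ('v \<Rightarrow> 'v \<Rightarrow> 'v) \<Rightarrow> 'v \<Rightarrow> 'v \<Rightarrow> 'v \<Rightarrow> 'v" where
  "jacobi_side V br x y z = br (br x y) z \<oplus>\<^bsub>V\<^esub> br (br z x) y \<oplus>\<^bsub>V\<^esub> br (br y z) x"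

definition associator_side ::
  "(real, 'v) module \<Rightarrow> ('v \<Rightarrow> 'v \<Rightarrow> 'v \<Rightarrow> 'v) \<Rightarrow> 'v \<Rightarrow> 'v \<Rightarrow> 'v \<Rightarrow> 'v" where
  "associator_side V asc x y z =
     asc x y z \<oplus>\<^bsub>V\<^esub> asc y z x \<oplus>\<^bsub>V\<^esub> asc z x y
       \<ominus>\<^bsub>V\<^esub> asc z y x \<ominus>\<^bsub>V\<^esub> asc x z y \<ominus>\<^bsub>V\<^esub> asc y x z"

definition akivis_algebra ::
  "(real, 'v) module \<Rightarrow> ('v \<Rightarrow> 'v \<Rightarrow> 'v) \<Rightarrow> ('v \<Rightarrow> 'v \<Rightarrow> 'v \<Rightarrow> 'v) \<Rightarrow> bool" where
  "akivis_algebra V br asc \<longleftrightarrow>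
     vectorspace class_ring V \<and> bilinear_on V br \<and> skew_on V br \<and> trilinear_on V asc \<and>
     (\<forall>x\<in>carrier V. \<forall>y\<in>carrier V. \<forall>z\<in>carrier V.
        jacobi_side V br x y z = associator_side V asc x y z)"

definition lie_algebra :: "(real, 'v) module \<Rightarrow> ('v \<Rightarrow> 'v \<Rightarrow> 'v) \<Rightarrow> bool" where
  "lie_algebra V br \<longleftrightarrow>
     vectorspace class_ring V \<and> bilinear_on V br \<and> skew_on V br \<and>
     (\<forall>x\<in>carrier V. \<forall>y\<in>carrier V. \<forall>z\<in>carrier V. jacobi_side V br x y z = \<zero>\<^bsub>V\<^esub>)"

section \<open>The Akivis algebra of the loop\<close>

definition tangent_module :: "nat \<Rightarrow> real mat set \<Rightarrow> (real, real vec \<times> real mat) module" where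
  "tangent_module n \<Gamma> =
     \<lparr> carrier = carrier_vec n \<times> lie_algebra_of n \<Gamma>,
       mult = undefined,
       one = undefined,
       zero = (0\<^sub>v n, 0\<^sub>m n n),
       add = (\<lambda>(x, m) (x', m'). (x + x', m + m')),
       smult = (\<lambda>c (x, m). (c \<cdot>\<^sub>v x, c \<cdot>\<^sub>m m)) \<rparr>"

definition exp_curve :: "real vec \<times> real mat \<Rightarrow> real \<Rightarrow> real vec \<times> real mat" where
  "exp_curve X t = (t \<cdot>\<^sub>v fst X, mat_exp (t \<cdot>\<^sub>m snd X))"

text \<open>
  \<open>coord_limit n \<Gamma> k f Z\<close> says that \<open>f t / t ^ k \<rightarrow> Z\<close> as \<open>t \<rightarrow> 0\<close>, where \<open>f t\<close> is read in the
  coordinates \<open>(x, exp m) \<leftrightarrow> (x, m)\<close>. For \<open>k > 0\<close> the convergence forces the coordinates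
  \<open>l t\<close> to tend to \<open>0\<close>; they are then determined for small \<open>t\<close>, because \<^const>\<open>mat_exp\<close> is
  injective near \<open>0\<close>, and so \<open>Z\<close> is unique.
\<close>

definition coord_limit ::
  "nat \<Rightarrow> real mat set \<Rightarrow> nat \<Rightarrow> (real \<Rightarrow> real vec \<times> real mat) \<Rightarrow> real vec \<times> real mat \<Rightarrow> bool"
where
  "coord_limit n \<Gamma> k f Z \<longleftrightarrow>
     Z \<in> carrier_vec n \<times> lie_algebra_of n \<Gamma> \<and>
     (\<exists>y l.
        (\<forall>\<^sub>F t in at 0. y t \<in> carrier_vec n \<and> l t \<in> lie_algebra_of n \<Gamma> \<and> f t = (y t, mat_exp (l t))) \<and>
        (\<forall>i<n. ((\<lambda>t. y t $ i / t ^ k) \<longlongrightarrow> fst Z $ i) (at 0)) \<and>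
        (\<forall>i<n. \<forall>j<n. ((\<lambda>t. l t $$ (i, j) / t ^ k) \<longlongrightarrow> snd Z $$ (i, j)) (at 0)))"

definition commutator_map ::
  "nat \<Rightarrow> real mat set \<Rightarrow> (real vec \<times> real mat) monoid \<Rightarrow>
   (real vec \<times> real mat \<Rightarrow> real vec \<times> real mat \<Rightarrow> real vec \<times> real mat) \<Rightarrow> bool"
where
  "commutator_map n \<Gamma> L br \<longleftrightarrow>
     (\<forall>X\<^sub>1 \<in> carrier (tangent_module n \<Gamma>). \<forall>X\<^sub>2 \<in> carrier (tangent_module n \<Gamma>).
        coord_limit n \<Gamma> 2
          (\<lambda>t. rdiv L (exp_curve X\<^sub>1 t \<otimes>\<^bsub>L\<^esub> exp_curve X\<^sub>2 t) (exp_curve X\<^sub>2 t \<otimes>\<^bsub>L\<^esub> exp_curve X\<^sub>1 t))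
          (br X\<^sub>1 X\<^sub>2))"

definition associator_map ::
  "nat \<Rightarrow> real mat set \<Rightarrow> (real vec \<times> real mat) monoid \<Rightarrow>
   (real vec \<times> real mat \<Rightarrow> real vec \<times> real mat \<Rightarrow> real vec \<times> real mat \<Rightarrow> real vec \<times> real mat) \<Rightarrow> bool"
where
  "associator_map n \<Gamma> L asc \<longleftrightarrow>
     (\<forall>X\<^sub>1 \<in> carrier (tangent_module n \<Gamma>). \<forall>X\<^sub>2 \<in> carrier (tangent_module n \<Gamma>).
      \<forall>X\<^sub>3 \<in> carrier (tangent_module n \<Gamma>).
        coord_limit n \<Gamma> 3
          (\<lambda>t. rdiv L
                 ((exp_curve X\<^sub>1 t \<otimes>\<^bsub>L\<^esub> exp_curve X\<^sub>2 t) \<otimes>\<^bsub>L\<^esub> exp_curve X\<^sub>3 t)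
                 (exp_curve X\<^sub>1 t \<otimes>\<^bsub>L\<^esub> (exp_curve X\<^sub>2 t \<otimes>\<^bsub>L\<^esub> exp_curve X\<^sub>3 t)))
          (asc X\<^sub>1 X\<^sub>2 X\<^sub>3))"

end

theory Submission
  imports Defs
begin

text \<open>
  Take \<open>n = 1\<close>, \<open>\<Gamma>\<^sub>0\<close> the full multiplicative group of the reals, \<open>m\<^sup>\<delta> = \<bar>m\<bar>\<close>, \<open>A = 1\<close> and \<open>B = 2\<close>.
  Then \<open>B - m\<^sup>\<delta> A m\<^sup>-\<^sup>1 = 2 - sgn m\<close> is nonzero and constant on each of the two components. On the
  identity component the multiplication therefore reduces to \<open>(u + m v, m k)\<close>, the affine group of
  the line, so the associators of small elements vanish and the commutators give the Lie algebra of
  the affine group. Associativity fails only once the other component is involved, because the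
  weight \<open>2 - sgn m\<close> takes the different values 1 and 3 on the two components.
\<close>

section \<open>Smooth functions and single-chart manifolds\<close>

text \<open>
  This class of functions contains the coordinate functions of all operations needed, and it is
  closed under partial derivatives on an open \<open>U\<close>, so that smoothness follows by induction.
\<close>

inductive rational_sgn :: "(nat \<Rightarrow> real) set \<Rightarrow> ((nat \<Rightarrow> real) \<Rightarrow> real) \<Rightarrow> bool"
  for U where
  proj: "rational_sgn U (\<lambda>x. x i)"
| const: "rational_sgn U (\<lambda>x. c)"
| add: "rational_sgn U f \<Longrightarrow> rational_sgn U g \<Longrightarrow> rational_sgn U (\<lambda>x. f x + g x)"
| mult: "rational_sgn U f \<Longrightarrow> rational_sgn U g \<Longrightarrow> rational_sgn U (\<lambda>x. f x * g x)"
| inverse: "rational_sgn U f \<Longrightarrow> (\<And>x. x \<in> U \<Longrightarrow> f x \<noteq> 0) \<Longrightarrow> rational_sgn U (\<lambda>x. inverse (f x))"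
| sgn: "rational_sgn U f \<Longrightarrow> (\<And>x. x \<in> U \<Longrightarrow> f x \<noteq> 0) \<Longrightarrow> rational_sgn U (\<lambda>x. sgn (f x))"

lemma rational_sgn_minus: "rational_sgn U f \<Longrightarrow> rational_sgn U (\<lambda>x. - f x)"
  using rational_sgn.mult[OF rational_sgn.const[of U "-1"], of f] by simp

lemma rational_sgn_diff:
  "rational_sgn U f \<Longrightarrow> rational_sgn U g \<Longrightarrow> rational_sgn U (\<lambda>x. f x - g x)"
  using rational_sgn.add[OF _ rational_sgn_minus] by simp

lemma rational_sgn_divide:
  "rational_sgn U f \<Longrightarrow> rational_sgn U g \<Longrightarrow> (\<And>x. x \<in> U \<Longrightarrow> g x \<noteq> 0) \<Longrightarrow>
   rational_sgn U (\<lambda>x. f x / g x)"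
  using rational_sgn.mult[OF _ rational_sgn.inverse] by (simp add: divide_inverse)

lemma rational_sgn_abs:
  "rational_sgn U f \<Longrightarrow> (\<And>x. x \<in> U \<Longrightarrow> f x \<noteq> 0) \<Longrightarrow> rational_sgn U (\<lambda>x. \<bar>f x\<bar>)"
  using rational_sgn.mult[OF _ rational_sgn.sgn] by (simp add: abs_sgn)

lemmas rational_sgn_intros = rational_sgn.intros rational_sgn_minus rational_sgn_diff
  rational_sgn_divide rational_sgn_abs

lemma rational_sgn_continuous:
  assumes "rational_sgn U f"
  shows "continuous_map (subtopology (Euclidean_space d) U) euclideanreal f"
  using assms
proof induction
  case (proj i)
  show ?case unfolding Euclidean_space_def
    by (intro continuous_map_from_subtopology continuous_map_product_projection) simp
next
  case (sgn f)
  \<comment> \<open>The identity sgn y = y / |y| holds for all reals, as inverse 0 = 0, and its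
    right side is continuous wherever \<open>f\<close> has no zero.\<close>
  have "continuous_map (subtopology (Euclidean_space d) U) euclideanreal (\<lambda>x. f x * inverse \<bar>f x\<bar>)"
    using sgn by (intro continuous_intros) auto
  then show ?case by (simp add: sgn_div_norm divide_inverse mult.commute)
qed (auto intro!: continuous_intros)

text \<open>By continuity \<open>h\<close> keeps its sign near \<open>a\<close>, so the composition
  with \<open>sgn\<close> is locally constant.\<close>

lemma has_real_derivative_sgn_zero:
  fixes h :: "real \<Rightarrow> real"
  assumes "isCont h a" "h a \<noteq> 0"
  shows "((\<lambda>s. sgn (h s)) has_real_derivative 0) (at a)"
proof -
  have "eventually (\<lambda>s. sgn (h s) = sgn (h a)) (nhds a)"
  proof (cases "h a > 0")
    case True
    then have "eventually (\<lambda>s. h s > 0) (nhds a)"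
      using assms(1) by (auto simp: isCont_def tendsto_at_iff_tendsto_nhds intro: order_tendstoD(1))
    then show ?thesis by eventually_elim (use True in simp)
  next
    case False
    then have "eventually (\<lambda>s. h s < 0) (nhds a)"
      using assms by (auto simp: isCont_def tendsto_at_iff_tendsto_nhds intro: order_tendstoD(2))
    then show ?thesis by eventually_elim (use False assms in simp)
  qed
  then show ?thesis by (subst DERIV_cong_ev[OF refl _ refl]) auto
qed

text \<open>The sum, product and inverse rules stay inside the class, and a sign contributes
  derivative 0. One \<open>g\<close> serves all points of \<open>U\<close>, so differentiation can
  be iterated.\<close>

lemma rational_sgn_partial:
  assumes "rational_sgn U f"
  shows "\<exists>g. rational_sgn U g \<and>
    (\<forall>x\<in>U. ((\<lambda>s. f (x(j := s))) has_real_derivative g x) (at (x j)))"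
  using assms
proof induction
  case (proj i)
  show ?case
    by (rule exI[of _ "\<lambda>x. if i = j then 1 else 0"]) (auto intro: rational_sgn.const)
next
  case (const c)
  show ?case by (rule exI[of _ "\<lambda>x. 0"]) (auto intro: rational_sgn.const)
next
  case (add f g)
  then obtain f' g' where D: "rational_sgn U f'" "rational_sgn U g'"
    "\<And>x. x \<in> U \<Longrightarrow> ((\<lambda>s. f (x(j := s))) has_real_derivative f' x) (at (x j))"
    "\<And>x. x \<in> U \<Longrightarrow> ((\<lambda>s. g (x(j := s))) has_real_derivative g' x) (at (x j))" by blast
  have "((\<lambda>s. f (x(j := s)) + g (x(j := s))) has_real_derivative f' x + g' x) (at (x j))"
    if "x \<in> U" for x
    by (rule DERIV_add[OF D(3)[OF that] D(4)[OF that]])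
  then show ?case using rational_sgn.add[OF D(1,2)] by blast
next
  case (mult f g)
  then obtain f' g' where D: "rational_sgn U f'" "rational_sgn U g'"
    "\<And>x. x \<in> U \<Longrightarrow> ((\<lambda>s. f (x(j := s))) has_real_derivative f' x) (at (x j))"
    "\<And>x. x \<in> U \<Longrightarrow> ((\<lambda>s. g (x(j := s))) has_real_derivative g' x) (at (x j))" by blast
  have "((\<lambda>s. f (x(j := s)) * g (x(j := s))) has_real_derivative f' x * g x + g' x * f x) (at (x
      j))"
    if "x \<in> U" for x
    using DERIV_mult[OF D(3)[OF that] D(4)[OF that]] by simp
  moreover have "rational_sgn U (\<lambda>x. f' x * g x + g' x * f x)"
    by (intro rational_sgn.add rational_sgn.mult D mult.hyps)
  ultimately show ?case by blast
next
  case (inverse f)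
  then obtain f' where D: "rational_sgn U f'"
    "\<And>x. x \<in> U \<Longrightarrow> ((\<lambda>s. f (x(j := s))) has_real_derivative f' x) (at (x j))" by blast
  have "((\<lambda>s. inverse (f (x(j := s)))) has_real_derivative - (inverse (f x) * f' x * inverse (f
      x))) (at (x j))"
    if "x \<in> U" for x
    using DERIV_inverse'[OF D(2)[OF that]] inverse.hyps(2)[OF that] by simp
  moreover have "rational_sgn U (\<lambda>x. - (inverse (f x) * f' x * inverse (f x)))"
    by (intro rational_sgn_minus rational_sgn.mult rational_sgn.inverse D inverse.hyps)
  ultimately show ?case by blast
next
  case (sgn f)
  then obtain f' where D:
    "\<And>x. x \<in> U \<Longrightarrow> ((\<lambda>s. f (x(j := s))) has_real_derivative f' x) (at (x j))" by blast
  have "((\<lambda>s. sgn (f (x(j := s)))) has_real_derivative 0) (at (x j))" if "x \<in> U" for x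
    using has_real_derivative_sgn_zero[OF DERIV_isCont[OF D[OF that]]] sgn.hyps(2)[OF that] by simp
  then show ?case using rational_sgn.const by blast
qed

text \<open>Partial derivatives look at a function along a whole segment through \<open>x\<close>.
  This lemma keeps a short segment inside \<open>U\<close>, where two functions are known to
  agree.\<close>

lemma eventually_update_in_openin:
  assumes "openin (Euclidean_space d) U" "x \<in> U" "j < d"
  shows "eventually (\<lambda>s. x(j := s) \<in> U) (nhds (x j))"
proof -
  have x: "x \<in> topspace (Euclidean_space d)" using assms openin_subset by blast
  have "continuous_map euclideanreal (Euclidean_space d) (\<lambda>s. x(j := s))"
    unfolding Euclidean_space_def using x \<open>j < d\<close>
    by (auto simp: continuous_map_in_subtopology continuous_map_componentwise_UNIV
        topspace_Euclidean_space fun_upd_def)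
  then have "open {s. x(j := s) \<in> U}"
    using openin_continuous_map_preimage[OF _ assms(1)] by force
  then show ?thesis using \<open>x \<in> U\<close> by (auto simp: eventually_nhds fun_upd_triv)
qed

text \<open>Agreement only on \<open>U\<close> is what survives the induction: the partial
  derivatives of \<open>f\<close> are again known on \<open>U\<close> only, and local
  representatives have arbitrary values outside the chart image.\<close>

lemma rational_sgn_C_k_on:
  assumes "openin (Euclidean_space d) U" "rational_sgn U g" "\<And>x. x \<in> U \<Longrightarrow> f x = g x"
  shows "C_k_on d k U f"
  using assms(2,3)
proof (induction k arbitrary: f g)
  case 0
  show ?case
    using continuous_map_eq[OF rational_sgn_continuous[OF 0(1), of d], of f] 0(2) by auto
next
  case (Suc k)
  have "(\<forall>x\<in>U. has_partial j f x) \<and> C_k_on d k U (partial_deriv j f)" if "j < d" for j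
  proof -
    obtain g' where g': "rational_sgn U g'"
      "\<And>x. x \<in> U \<Longrightarrow> ((\<lambda>s. g (x(j := s))) has_real_derivative g' x) (at (x j))"
      using rational_sgn_partial[OF Suc.prems(1)] by blast
    have *: "((\<lambda>s. f (x(j := s))) has_real_derivative g' x) (at (x j))" if "x \<in> U" for x
    proof -
      have "eventually (\<lambda>s. f (x(j := s)) = g (x(j := s))) (nhds (x j))"
        using eventually_update_in_openin[OF assms(1) that \<open>j < d\<close>]
        by eventually_elim (rule Suc.prems(2))
      then show ?thesis using g'(2)[OF that] by (subst DERIV_cong_ev[OF refl _ refl])
    qed
    have "C_k_on d k U (partial_deriv j f)"
      by (rule Suc.IH[OF g'(1)]) (simp add: partial_deriv_def DERIV_imp_deriv[OF *])
    then show ?thesis using * by (auto simp: has_partial_def real_differentiable_def)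
  qed
  moreover have "continuous_map (subtopology (Euclidean_space d) U) euclideanreal f"
    using continuous_map_eq[OF rational_sgn_continuous[OF Suc.prems(1), of d], of f] Suc.prems(2)
    by auto
  ultimately show ?case by simp
qed

lemma rational_sgn_C_infinity_on:
  assumes "openin (Euclidean_space d) U" "rational_sgn U g" "\<And>x. x \<in> U \<Longrightarrow> f x = g x"
  shows "C_infinity_on d U f"
  using rational_sgn_C_k_on[OF assms] by (simp add: C_infinity_on_def)

text \<open>All manifolds needed have one chart that covers the whole space, even the disconnected
  GL(1,R), which is the line without 0. The only transition map is then the identity.\<close>

definition global_chart :: "'a manifold \<Rightarrow> ('a \<Rightarrow> nat \<Rightarrow> real) \<Rightarrow> ((nat \<Rightarrow> real) \<Rightarrow> 'a) \<Rightarrow> bool" where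
  "global_chart M \<phi> \<psi> \<longleftrightarrow>
     atlas M = {(topspace (mtop M), \<phi>)} \<and>
     openin (Euclidean_space (mdim M)) (\<phi> ` topspace (mtop M)) \<and>
     homeomorphic_maps (mtop M) (subtopology (Euclidean_space (mdim M)) (\<phi> ` topspace (mtop M)))
         \<phi> \<psi>"

lemma global_chart_inverse:
  "global_chart M \<phi> \<psi> \<Longrightarrow> p \<in> topspace (mtop M) \<Longrightarrow> \<psi> (\<phi> p) = p"
  by (simp add: global_chart_def homeomorphic_maps_def)

lemma global_chart_inv_into:
  assumes "global_chart M \<phi> \<psi>" "p \<in> topspace (mtop M)"
  shows "inv_into (topspace (mtop M)) \<phi> (\<phi> p) = p"
  using assms by (intro inv_into_f_f inj_on_inverseI[of _ \<psi>]) (auto simp: global_chart_inverse)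

text \<open>The space of all real sequences has a countable basis, and second countability passes to
  subspaces.\<close>

lemma second_countable_Euclidean_space: "second_countable (Euclidean_space d)"
proof -
  obtain B :: "(nat \<Rightarrow> real) set set" where B: "countable B" "topological_basis B"
    using ex_countable_basis by blast
  have "second_countable (euclidean :: (nat \<Rightarrow> real) topology)"
    unfolding second_countable_def
  proof (intro exI conjI ballI allI impI)
    show "countable B" by fact
    show "openin euclidean V" if "V \<in> B" for V
      using that B(2) by (auto simp: topological_basis_open)
    show "\<exists>V\<in>B. x \<in> V \<and> V \<subseteq> U" if "openin euclidean U \<and> x \<in> U" for U x
      using that topological_basisE[OF B(2), of U x] by auto
  qed
  then show ?thesis
    unfolding Euclidean_space_def euclidean_product_topology
    by (rule second_countable_subtopology)
qed

lemma global_chart_smooth_manifold: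
  assumes "global_chart M \<phi> \<psi>"
  shows "smooth_manifold M"
proof -
  let ?T = "topspace (mtop M)"
  let ?E = "subtopology (Euclidean_space (mdim M)) (\<phi> ` ?T)"
  have at: "atlas M = {(?T, \<phi>)}" and op: "openin (Euclidean_space (mdim M)) (\<phi> ` ?T)"
    and ho: "homeomorphic_maps (mtop M) ?E \<phi> \<psi>"
    using assms by (auto simp: global_chart_def)
  have hom: "homeomorphic_map (mtop M) ?E \<phi>" using ho homeomorphic_maps_map by blast
  have hs: "mtop M homeomorphic_space ?E" using ho homeomorphic_space_def by blast
  have "Hausdorff_space (mtop M)"
    using homeomorphic_Hausdorff_space[OF hs] Hausdorff_space_subtopology
      Hausdorff_Euclidean_space by blast
  moreover have "second_countable (mtop M)"
    using homeomorphic_space_second_countability[OF hs] second_countable_subtopology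
      second_countable_Euclidean_space by blast
  moreover have "is_chart (mtop M) (mdim M) (?T, \<phi>)"
    using op hom by (simp add: is_chart_def)
  moreover have "C_infinity_on (mdim M) (\<phi> ` ?T) (\<lambda>x. local_rep (?T, \<phi>) (?T, \<phi>) id x i)" for i
    by (rule rational_sgn_C_infinity_on[OF op rational_sgn.proj[of _ i]])
      (auto simp: local_rep_def global_chart_inv_into[OF assms])
  ultimately show ?thesis unfolding smooth_manifold_def by (auto simp: at)
qed

text \<open>Smoothness is reduced to exhibiting each target coordinate as a member of
  \<open>rational_sgn\<close>. Continuity between the manifolds is a separate clause of
  \<open>smooth_map\<close>; it follows by composing the coordinate expression with the inverse
  chart of the target.\<close>

lemma global_chart_smooth_map:
  assumes M: "global_chart M \<phi> \<psi>" and N: "global_chart N \<phi>' \<psi>'"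
    and f: "\<And>p. p \<in> topspace (mtop M) \<Longrightarrow> f p \<in> topspace (mtop N)"
    and g: "\<And>i. i < mdim N \<Longrightarrow> rational_sgn (\<phi> ` topspace (mtop M)) (g i)"
    and eq: "\<And>p i. p \<in> topspace (mtop M) \<Longrightarrow> i < mdim N \<Longrightarrow> \<phi>' (f p) i = g i (\<phi> p)"
  shows "smooth_map M N f"
proof -
  let ?T = "topspace (mtop M)" and ?S = "topspace (mtop N)"
  let ?E = "subtopology (Euclidean_space (mdim M)) (\<phi> ` ?T)"
  let ?F = "subtopology (Euclidean_space (mdim N)) (\<phi>' ` ?S)"
  have \<phi>: "continuous_map (mtop M) ?E \<phi>" and op: "openin (Euclidean_space (mdim M)) (\<phi> ` ?T)"
    and atM: "atlas M = {(?T, \<phi>)}"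
    using M by (auto simp: global_chart_def homeomorphic_maps_def)
  have \<psi>': "continuous_map ?F (mtop N) \<psi>'" and \<phi>': "continuous_map (mtop N) ?F \<phi>'"
    and atN: "atlas N = {(?S, \<phi>')}"
    using N by (auto simp: global_chart_def homeomorphic_maps_def)
  have E: "\<phi>' q \<in> topspace (Euclidean_space (mdim N))" if "q \<in> ?S" for q
    using continuous_map_image_subset_topspace[OF \<phi>'] that by auto
  \<comment> \<open>Points of the model space vanish from index \<open>mdim N\<close> on, so the
    remaining coordinates are filled with 0.\<close>
  have "continuous_map (mtop M) (Euclidean_space (mdim N))
      (\<lambda>p i. if i < mdim N then g i (\<phi> p) else 0)"
    unfolding continuous_map_componentwise_Euclidean_space
    using continuous_map_compose[OF \<phi> rational_sgn_continuous[OF g]] by (simp add: o_def)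
  then have "continuous_map (mtop M) (Euclidean_space (mdim N)) (\<lambda>p. \<phi>' (f p))"
    by (rule continuous_map_eq)
      (use E f eq in \<open>fastforce simp: topspace_Euclidean_space fun_eq_iff not_less\<close>)
  then have "continuous_map (mtop M) ?F (\<lambda>p. \<phi>' (f p))"
    using f by (auto simp: continuous_map_in_subtopology)
  from continuous_map_compose[OF this \<psi>']
  have cont: "continuous_map (mtop M) (mtop N) f"
    by (rule continuous_map_eq) (use f global_chart_inverse[OF N] in simp)
  have dom: "?T \<inter> f -` ?S = ?T" using f by auto
  have "C_infinity_on (mdim M) (\<phi> ` ?T) (\<lambda>x. local_rep (?T, \<phi>) (?S, \<phi>') f x i)"
      if "i < mdim N" for i
    by (rule rational_sgn_C_infinity_on[OF op g[OF that]])
      (use that eq in \<open>auto simp: local_rep_def global_chart_inv_into[OF M]\<close>)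
  then show ?thesis using cont by (simp add: smooth_map_def atM atN dom)
qed

section \<open>Products, pullback topologies and the identity immersion\<close>

definition prod_coords :: "nat \<Rightarrow> ('a \<Rightarrow> nat \<Rightarrow> real) \<Rightarrow> ('b \<Rightarrow> nat \<Rightarrow> real) \<Rightarrow> 'a \<times> 'b \<Rightarrow> nat \<Rightarrow> real" where
  "prod_coords d \<phi> \<phi>' = (\<lambda>(p, q) i. if i < d then \<phi> p i else \<phi>' q (i - d))"

lemma continuous_map_into_Euclidean_spaceI:
  assumes "\<And>i. i < d \<Longrightarrow> continuous_map X euclideanreal (\<lambda>x. f x i)"
    and "\<And>x i. x \<in> topspace X \<Longrightarrow> d \<le> i \<Longrightarrow> f x i = 0"
  shows "continuous_map X (Euclidean_space d) f"
proof -
  have "continuous_map X (Euclidean_space d) (\<lambda>x i. if i < d then f x i else 0)"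
    using assms(1) by (simp add: continuous_map_componentwise_Euclidean_space)
  then show ?thesis
    by (rule continuous_map_eq) (use assms(2) in \<open>auto simp: fun_eq_iff\<close>)
qed

lemma continuous_map_Euclidean_space_component:
  "continuous_map (Euclidean_space d) euclideanreal (\<lambda>x. x i)"
  using rational_sgn_continuous[OF rational_sgn.proj, of d UNIV i] by simp

text \<open>The inverse chart cuts the sequence at index \<open>mdim M\<close>: the first block is
  padded with zeros, the second is shifted back to index 0.\<close>

lemma global_chart_prod:
  assumes M: "global_chart M \<phi> \<psi>" and N: "global_chart N \<phi>' \<psi>'"
  shows "global_chart (prod_manifold M N) (prod_coords (mdim M) \<phi> \<phi>')
    (\<lambda>x. (\<psi> (\<lambda>i. if i < mdim M then x i else 0), \<psi>' (\<lambda>i. x (i + mdim M))))"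
proof -
  define d e where "d = mdim M" and "e = mdim N"
  define S T where "S = topspace (mtop M)" and "T = topspace (mtop N)"
  define \<Phi> where "\<Phi> = prod_coords d \<phi> \<phi>'"
  \<comment> \<open>These recover the coordinates of the two factors from those of the pair. The
    truncation in \<open>a\<close> is what puts its values into
    \<open>Euclidean_space d\<close>.\<close>
  define a b where "a = (\<lambda>x i. if i < d then x i else 0 :: real)"
    and "b = (\<lambda>(x::nat\<Rightarrow>real) i. x (i + d))"
  have opM: "openin (Euclidean_space d) (\<phi> ` S)" and opN: "openin (Euclidean_space e) (\<phi>' ` T)"
    and \<phi>: "continuous_map (mtop M) (Euclidean_space d) \<phi>"
    and \<phi>': "continuous_map (mtop N) (Euclidean_space e) \<phi>'"
    and \<psi>: "continuous_map (subtopology (Euclidean_space d) (\<phi> ` S)) (mtop M) \<psi>"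
    and \<psi>': "continuous_map (subtopology (Euclidean_space e) (\<phi>' ` T)) (mtop N) \<psi>'"
    and at: "atlas M = {(S, \<phi>)}" "atlas N = {(T, \<phi>')}"
    using M N by (auto simp: global_chart_def homeomorphic_maps_def d_def e_def S_def T_def
        continuous_map_in_subtopology)
  have \<phi>0: "\<phi> p i = 0" if "p \<in> S" "d \<le> i" for p i
    using continuous_map_image_subset_topspace[OF \<phi>] that
    by (auto simp: topspace_Euclidean_space S_def)
  have \<phi>'0: "\<phi>' p i = 0" if "p \<in> T" "e \<le> i" for p i
    using continuous_map_image_subset_topspace[OF \<phi>'] that
    by (auto simp: topspace_Euclidean_space T_def)
  have a\<Phi>: "a (\<Phi> (p, q)) = \<phi> p" if "p \<in> S" for p q
    using \<phi>0[OF that] by (auto simp: a_def \<Phi>_def prod_coords_def fun_eq_iff)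
  have b\<Phi>: "b (\<Phi> (p, q)) = \<phi>' q" for p q
    by (auto simp: b_def \<Phi>_def prod_coords_def fun_eq_iff)
  have ca: "continuous_map (Euclidean_space (d + e)) (Euclidean_space d) a"
    by (rule continuous_map_into_Euclidean_spaceI)
      (auto simp: a_def continuous_map_Euclidean_space_component)
  have cb: "continuous_map (Euclidean_space (d + e)) (Euclidean_space e) b"
    by (rule continuous_map_into_Euclidean_spaceI)
      (auto simp: b_def continuous_map_Euclidean_space_component topspace_Euclidean_space)
  have c\<Phi>: "continuous_map (prod_topology (mtop M) (mtop N)) (Euclidean_space (d + e)) \<Phi>"
  proof (rule continuous_map_into_Euclidean_spaceI)
    fix i
    have "continuous_map (prod_topology (mtop M) (mtop N)) euclideanreal (\<lambda>z. \<phi> (fst z) i)"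
      using continuous_map_compose[OF continuous_map_fst
          continuous_map_compose[OF \<phi> continuous_map_Euclidean_space_component[of d i]]]
      by (simp add: o_def)
    moreover have "continuous_map (prod_topology (mtop M) (mtop N)) euclideanreal (\<lambda>z. \<phi>' (snd z)
        (i - d))"
      using continuous_map_compose[OF continuous_map_snd
          continuous_map_compose[OF \<phi>' continuous_map_Euclidean_space_component[of e "i - d"]]]
      by (simp add: o_def)
    ultimately show "continuous_map (prod_topology (mtop M) (mtop N)) euclideanreal (\<lambda>z. \<Phi> z i)"
      by (cases "i < d") (simp_all add: \<Phi>_def prod_coords_def case_prod_unfold)
  qed (auto simp: \<Phi>_def prod_coords_def \<phi>0 \<phi>'0 T_def)
  \<comment> \<open>This form shows that the image is open: it is the intersection of preimages of
    open sets under the continuous maps \<open>a\<close> and \<open>b\<close>.\<close>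
  have im: "\<Phi> ` (S \<times> T) =
      {x \<in> topspace (Euclidean_space (d + e)). a x \<in> \<phi> ` S} \<inter>
      {x \<in> topspace (Euclidean_space (d + e)). b x \<in> \<phi>' ` T}" (is "_ = ?R")
  proof (intro subset_antisym subsetI)
    fix x assume "x \<in> \<Phi> ` (S \<times> T)"
    then obtain p q where x: "x = \<Phi> (p, q)" "p \<in> S" "q \<in> T" by auto
    then show "x \<in> ?R"
      using continuous_map_image_subset_topspace[OF c\<Phi>] by (auto simp: a\<Phi> b\<Phi> S_def T_def)
  next
    fix x assume "x \<in> ?R"
    then obtain p q where "p \<in> S" "q \<in> T" and pq: "a x = \<phi> p" "b x = \<phi>' q" by auto
    moreover have "x = \<Phi> (p, q)"
    proof
      fix i show "x i = \<Phi> (p, q) i"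
        using fun_cong[OF pq(1), of i] fun_cong[OF pq(2), of "i - d"]
        by (auto simp: \<Phi>_def prod_coords_def a_def b_def)
    qed
    ultimately show "x \<in> \<Phi> ` (S \<times> T)" by blast
  qed
  have op: "openin (Euclidean_space (d + e)) (\<Phi> ` (S \<times> T))"
    unfolding im
    by (intro openin_Int openin_continuous_map_preimage[OF ca opM]
        openin_continuous_map_preimage[OF cb opN])
  let ?X = "subtopology (Euclidean_space (d + e)) (\<Phi> ` (S \<times> T))"
  have "continuous_map ?X (mtop M) (\<psi> \<circ> a)"
    using ca \<psi> by (intro continuous_map_compose[OF _ \<psi>])
      (auto simp: continuous_map_in_subtopology continuous_map_from_subtopology a\<Phi>)
  moreover have "continuous_map ?X (mtop N) (\<psi>' \<circ> b)"
    using cb \<psi>' by (intro continuous_map_compose[OF _ \<psi>'])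
      (auto simp: continuous_map_in_subtopology continuous_map_from_subtopology b\<Phi>)
  ultimately have c\<Psi>: "continuous_map ?X (prod_topology (mtop M) (mtop N)) (\<lambda>x. (\<psi> (a x), \<psi>' (b
      x)))"
    by (simp add: continuous_map_pairwise o_def)
  have "homeomorphic_maps (prod_topology (mtop M) (mtop N)) ?X \<Phi> (\<lambda>x. (\<psi> (a x), \<psi>' (b x)))"
    unfolding homeomorphic_maps_def
    using c\<Phi> c\<Psi> global_chart_inverse[OF M] global_chart_inverse[OF N]
    by (auto simp: continuous_map_in_subtopology a\<Phi> b\<Phi> S_def T_def)
  then show ?thesis
    using op at
    by (auto simp: global_chart_def prod_manifold_def prod_chart_def d_def[symmetric]
        e_def[symmetric]
        S_def[symmetric] T_def[symmetric] \<Phi>_def a_def b_def prod_coords_def cong: if_cong)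
qed

text \<open>The topology pulled back along an injection makes that injection a homeomorphism onto
  its image. Both \<open>vec_manifold\<close> and \<open>GL_manifold\<close> are built this
  way.\<close>

lemma global_chart_pullback:
  assumes at: "atlas M = {(C, \<phi>)}" and top: "mtop M =
      pullback_topology C \<phi> (Euclidean_space (mdim M))"
    and inj: "inj_on \<phi> C" and op: "openin (Euclidean_space (mdim M)) (\<phi> ` C)"
  shows "global_chart M \<phi> (inv_into C \<phi>)"
proof -
  have sub: "\<phi> ` C \<subseteq> topspace (Euclidean_space (mdim M))" using op openin_subset by blast
  then have ts: "topspace (mtop M) = C" by (auto simp: top topspace_pullback_topology)
  have "continuous_map (mtop M) (Euclidean_space (mdim M)) \<phi>"
    using continuous_map_pullback[OF continuous_map_id] by (simp add: top)
  moreover have "continuous_map (subtopology (Euclidean_space (mdim M)) (\<phi> ` C)) (mtop M)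
      (inv_into C \<phi>)"
    unfolding top
  proof (rule continuous_map_pullback')
    show "continuous_map (subtopology (Euclidean_space (mdim M)) (\<phi> ` C)) (Euclidean_space (mdim M))
        (\<phi> \<circ> inv_into C \<phi>)"
      by (rule continuous_map_eq[OF continuous_map_from_subtopology[OF continuous_map_id]])
        (auto simp: f_inv_into_f)
    show "topspace (subtopology (Euclidean_space (mdim M)) (\<phi> ` C)) \<subseteq> inv_into C \<phi> -` C"
      by (auto intro: inv_into_into)
  qed
  ultimately show ?thesis
    using at op inj sub by (auto simp: global_chart_def ts homeomorphic_maps_def
        continuous_map_in_subtopology f_inv_into_f)
qed

lemma global_chart_immersion_id:
  assumes M: "global_chart M \<phi> \<psi>"
  shows "immersion M M (\<lambda>p. p)"
proof -
  let ?T = "topspace (mtop M)"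
  have op: "openin (Euclidean_space (mdim M)) (\<phi> ` ?T)" and at: "atlas M = {(?T, \<phi>)}"
    using M by (auto simp: global_chart_def)
  have "smooth_map M M (\<lambda>p. p)"
    by (rule global_chart_smooth_map[OF M M, of _ "\<lambda>i x. x i"]) (auto intro: rational_sgn.proj)
  moreover have "partial_deriv j (\<lambda>x. local_rep (?T, \<phi>) (?T, \<phi>) (\<lambda>p. p) x i) (\<phi> p) =
      (if i = j then 1 else 0)" if "p \<in> ?T" "j < mdim M" for i j p
  proof -
    \<comment> \<open>The local representative is the identity only on the chart image. This image
      is open, so the partial derivatives are those of the identity and the Jacobian is the unit
      matrix.\<close>
    have "eventually (\<lambda>s. local_rep (?T, \<phi>) (?T, \<phi>) (\<lambda>p. p) ((\<phi> p)(j := s)) i = ((\<phi> p)(j := s)) i)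
        (nhds (\<phi> p j))"
      using eventually_update_in_openin[OF op imageI[OF that(1)] that(2)]
      by eventually_elim (auto simp: local_rep_def f_inv_into_f)
    then have "partial_deriv j (\<lambda>x. local_rep (?T, \<phi>) (?T, \<phi>) (\<lambda>p. p) x i) (\<phi> p) =
        deriv (\<lambda>s. ((\<phi> p)(j := s)) i) (\<phi> p j)"
      unfolding partial_deriv_def by (rule deriv_cong_ev) simp
    then show ?thesis by auto
  qed
  ultimately show ?thesis
    by (auto simp: immersion_def at if_distrib[of "\<lambda>c. c * _"] cong: if_cong)
qed

section \<open>One-by-one matrices\<close>

declare One_nat_def [simp del] \<comment> \<open>otherwise the rules about dimension \<open>1\<close> do not match\<close>

text \<open>Matrices and vectors of size 1 are identified with reals, so that all later computations
  become real arithmetic.\<close>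

definition smat :: "real \<Rightarrow> real mat" where "smat a = mat 1 1 (\<lambda>_. a)"
definition svec :: "real \<Rightarrow> real vec" where "svec a = vec 1 (\<lambda>_. a)"

lemma smat_simps [simp]:
  "smat a $$ (0, 0) = a" "dim_row (smat a) = 1" "dim_col (smat a) = 1"
  "smat a \<in> carrier_mat 1 1" "smat a \<in> carrier_mat (Suc 0) (Suc 0)"
  "smat a = smat b \<longleftrightarrow> a = b" "smat a * smat b = smat (a * b)" "smat a + smat b = smat (a + b)"
  "smat a - smat b = smat (a - b)" "c \<cdot>\<^sub>m smat a = smat (c * a)"
proof -
  show 1: "smat a $$ (0, 0) = a" for a by (simp add: smat_def)
  show "smat a = smat b \<longleftrightarrow> a = b" using 1[of a] 1[of b] by metis
qed (auto simp: smat_def scalar_prod_def intro!: eq_matI)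

lemma svec_simps [simp]:
  "svec a $ 0 = a" "dim_vec (svec a) = 1"
  "svec a \<in> carrier_vec 1" "svec a \<in> carrier_vec (Suc 0)"
  "svec a = svec b \<longleftrightarrow> a = b" "svec a + svec b = svec (a + b)" "svec a - svec b = svec (a - b)"
  "c \<cdot>\<^sub>v svec a = svec (c * a)" "smat b *\<^sub>v svec a = svec (b * a)"
proof -
  show 1: "svec a $ 0 = a" for a by (simp add: svec_def)
  show "svec a = svec b \<longleftrightarrow> a = b" using 1[of a] 1[of b] by metis
qed (auto simp: smat_def svec_def scalar_prod_def intro!: eq_vecI)

lemma one_mat_smat: "1\<^sub>m 1 = smat 1" by (auto simp: smat_def)
lemma zero_mat_smat: "0\<^sub>m 1 1 = smat 0" by (auto simp: smat_def)
lemma zero_vec_svec: "0\<^sub>v 1 = svec 0" by (auto simp: svec_def)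

lemma carrier_mat_1: "carrier_mat 1 1 = range smat"
proof -
  have "X = smat (X $$ (0, 0))" if "X \<in> carrier_mat 1 1" for X
    using that by (intro eq_matI) (auto simp: smat_def)
  then show ?thesis by auto
qed

lemma carrier_vec_1: "carrier_vec 1 = range svec"
proof -
  have "v = svec (v $ 0)" if "v \<in> carrier_vec 1" for v
    using that by (intro eq_vecI) (auto simp: svec_def)
  then show ?thesis by auto
qed

section \<open>The group GL(1,R), its exponential map and its Lie algebra\<close>

lemma mult_GL [simp]: "X \<otimes>\<^bsub>GL n\<^esub> Y = X * Y"
  by (simp add: GL_def units_of_def ring_mat_def)

lemma one_GL [simp]: "\<one>\<^bsub>GL n\<^esub> = 1\<^sub>m n"
  by (simp add: GL_def units_of_def ring_mat_def)

lemma group_GL: "group (GL n)"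
proof -
  interpret ring "ring_mat TYPE(real) n ()" by (rule ring_mat)
  show ?thesis unfolding GL_def by (rule units_group)
qed

lemma smat_in_GL [simp]: "smat a \<in> carrier (GL 1) \<longleftrightarrow> a \<noteq> 0"
proof -
  have "smat a \<in> carrier (GL 1) \<longleftrightarrow> (\<exists>Y\<in>carrier_mat 1 1. Y * smat a = smat 1 \<and> smat a * Y = smat 1)"
    by (simp add: GL_def units_of_def Units_def ring_mat_def one_mat_smat)
  also have "\<dots> \<longleftrightarrow> (\<exists>b. b * a = 1 \<and> a * b = 1)"
    unfolding carrier_mat_1 by simp
  also have "\<dots> \<longleftrightarrow> a \<noteq> 0"
    by (auto intro: exI[of _ "inverse a"])
  finally show ?thesis .
qed

lemma carrier_GL_1: "carrier (GL 1) = smat ` (- {0})"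
proof -
  have "carrier (GL 1) \<subseteq> range smat"
    unfolding carrier_mat_1[symmetric] by (auto simp: GL_def units_of_def Units_def ring_mat_def)
  then show ?thesis by auto
qed

lemma inv_GL_smat: "a \<noteq> 0 \<Longrightarrow> inv\<^bsub>GL 1\<^esub> (smat a) = smat (inverse a)"
  by (rule group.inv_equality[OF group_GL]) (simp_all add: one_mat_smat)

text \<open>Powers of a one-by-one matrix are powers of its entry, so the matrix series is the real
  exponential series.\<close>

lemma mat_exp_smat: "mat_exp (smat a) = smat (exp a)"
proof -
  have "smat a ^\<^sub>m k = smat (a ^ k)" for k
    by (induction k) (simp_all add: one_mat_smat power_commutes)
  then show ?thesis
    by (auto simp: mat_exp_def exp_def smat_def divide_inverse_commute intro!: eq_matI)
qed

text \<open>The real exponential never vanishes, so every one-parameter curve stays in the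
  group.\<close>

lemma lie_algebra_of_GL_1: "lie_algebra_of 1 (carrier (GL 1)) = range smat"
  by (auto simp: lie_algebra_of_def carrier_mat_1 mat_exp_smat)

lemma vec_coords_svec: "vec_coords 1 (svec a) i = (if i = 0 then a else 0)"
  by (simp add: vec_coords_def)

lemma mat_coords_smat: "mat_coords 1 (smat a) i = (if i = 0 then a else 0)"
  by (simp add: mat_coords_def)

section \<open>Charts of the line and of GL(1,R), and the Lie group structure\<close>

lemma global_chart_vec:
  "global_chart (vec_manifold 1) (vec_coords 1) (inv_into (carrier_vec 1) (vec_coords 1))"
proof (rule global_chart_pullback)
  show "inj_on (vec_coords 1) (carrier_vec 1)"
    by (auto simp: inj_on_def carrier_vec_1 vec_coords_svec fun_eq_iff)
  have "vec_coords 1 ` carrier_vec 1 = topspace (Euclidean_space 1)"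
  proof (intro subset_antisym subsetI)
    fix x assume "x \<in> topspace (Euclidean_space 1)"
    then have "x = vec_coords 1 (svec (x 0))"
      by (auto simp: fun_eq_iff vec_coords_svec topspace_Euclidean_space)
    then show "x \<in> vec_coords 1 ` carrier_vec 1" by (metis imageI svec_simps(3))
  qed (auto simp: carrier_vec_1 vec_coords_svec topspace_Euclidean_space)
  then show "openin (Euclidean_space (mdim (vec_manifold 1))) (vec_coords 1 ` carrier_vec 1)"
    by (simp add: vec_manifold_def)
qed (simp_all add: vec_manifold_def)

lemma mat_coords_GL_1:
  "mat_coords 1 ` carrier (GL 1) = {x \<in> topspace (Euclidean_space 1). x 0 \<in> - {0}}"
proof (intro subset_antisym subsetI)
  fix x assume x: "x \<in> {x \<in> topspace (Euclidean_space 1). x 0 \<in> - {0}}"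
  then have "x = mat_coords 1 (smat (x 0))"
    by (auto simp: fun_eq_iff mat_coords_smat topspace_Euclidean_space)
  then show "x \<in> mat_coords 1 ` carrier (GL 1)" using x by (intro image_eqI) auto
qed (auto simp: carrier_GL_1 mat_coords_smat topspace_Euclidean_space)

lemma global_chart_GL:
  "global_chart (GL_manifold 1) (mat_coords 1) (inv_into (carrier (GL 1)) (mat_coords 1))"
proof (rule global_chart_pullback)
  show "inj_on (mat_coords 1) (carrier (GL 1))"
    by (auto simp: inj_on_def carrier_GL_1 mat_coords_smat fun_eq_iff)
  show "openin (Euclidean_space (mdim (GL_manifold 1))) (mat_coords 1 ` carrier (GL 1))"
    using openin_continuous_map_preimage[OF continuous_map_Euclidean_space_component[of 1 0],
        of "- {0}"]
    by (simp add: mat_coords_GL_1 GL_manifold_def open_delete Compl_eq_Diff_UNIV)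
qed (simp_all add: GL_manifold_def)

lemma topspace_GL_1: "topspace (mtop (GL_manifold 1)) = carrier (GL 1)"
  using mat_coords_GL_1 by (auto simp: GL_manifold_def topspace_pullback_topology)

lemma topspace_vec_1: "topspace (mtop (vec_manifold 1)) = carrier_vec 1"
  by (auto simp: vec_manifold_def topspace_pullback_topology topspace_Euclidean_space
      vec_coords_def)

lemma mdim_simps [simp]: "mdim (GL_manifold n) = n * n" "mdim (vec_manifold n) = n"
  "mdim (prod_manifold M N) = mdim M + mdim N"
  by (simp_all add: GL_manifold_def vec_manifold_def prod_manifold_def)

lemma topspace_prod_manifold [simp]:
  "topspace (mtop (prod_manifold M N)) = topspace (mtop M) \<times> topspace (mtop N)"
  by (simp add: prod_manifold_def)

text \<open>The subgroup is the whole group with its standard manifold structure, so the inclusion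
  is the identity immersion.\<close>

lemma lie_subgroup_GL_1: "lie_subgroup_GL 1 (carrier (GL 1)) (GL_manifold 1)"
proof -
  note C = global_chart_GL
  have eq: "GL 1\<lparr>carrier := carrier (GL 1)\<rparr> = GL 1" by (cases "GL 1") simp
  have "smooth_map (prod_manifold (GL_manifold 1) (GL_manifold 1)) (GL_manifold 1) (\<lambda>(x, y). x * y)"
    by (rule global_chart_smooth_map[OF global_chart_prod[OF C C] C, of _ "\<lambda>i x. x 0 * x 1"])
      (auto simp: topspace_GL_1 carrier_GL_1 prod_coords_def mat_coords_smat intro!:
          rational_sgn_intros)
  moreover have "smooth_map (GL_manifold 1) (GL_manifold 1) (\<lambda>x. inv\<^bsub>GL 1\<^esub> x)"
  proof (rule global_chart_smooth_map[OF C C, of _ "\<lambda>i x. inverse (x 0)"])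
    fix p i assume p: "p \<in> topspace (mtop (GL_manifold 1))" "i < mdim (GL_manifold 1)"
    then obtain a where "p = smat a" "a \<noteq> 0" by (auto simp: topspace_GL_1 carrier_GL_1)
    then show "mat_coords 1 (inv\<^bsub>GL 1\<^esub> p) i = inverse (mat_coords 1 p 0)"
      using p by (simp add: inv_GL_smat mat_coords_smat)
  qed (auto simp: topspace_GL_1 carrier_GL_1 mat_coords_smat inv_GL_smat intro!:
      rational_sgn_intros)
  ultimately show ?thesis
    using group_GL[of 1] global_chart_smooth_manifold[OF C] global_chart_immersion_id[OF C]
    by (simp add: lie_subgroup_GL_def lie_group_def eq topspace_GL_1 group.subgroup_self)
qed

section \<open>The loop\<close>

text \<open>This is the endomorphism \<delta>. It is the identity on the positive component and
  forgets the sign on the other one.\<close>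

definition abs_entry :: "real mat \<Rightarrow> real mat" where
  "abs_entry X = smat \<bar>X $$ (0, 0)\<bar>"

lemma abs_entry_smat [simp]: "abs_entry (smat a) = smat \<bar>a\<bar>"
  by (simp add: abs_entry_def)

abbreviation sign_loop :: "(real vec \<times> real mat) monoid" where
  "sign_loop \<equiv> L_Xi 1 (smat 1) (smat 2) (carrier (GL 1)) abs_entry"

text \<open>This is the scalar \<open>Xi_diff\<close> for \<open>A = 1\<close> and
  \<open>B = 2\<close>, because |a| / a = sgn a. Its values 1, 2 and 3 are positive, so it can be
  divided by without a side condition on \<open>a\<close>.\<close>

definition wt :: "real \<Rightarrow> real" where "wt a = 2 - sgn a"

lemma wt_pos: "wt a > 0" by (simp add: wt_def sgn_if)
lemma wt_nz [simp]: "wt a \<noteq> 0" using wt_pos[of a] by simp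

lemma Xi_diff_smat:
  assumes "a \<noteq> 0"
  shows "Xi_diff 1 (smat 1) (smat 2) abs_entry (smat a) = smat (wt a)"
  using assms by (simp add: Xi_diff_def inv_GL_smat wt_def sgn_if divide_simps)

lemma carrier_sign_loop: "carrier sign_loop = {(svec u, smat a) | u a. a \<noteq> 0}"
  by (auto simp: L_Xi_def carrier_vec_1 carrier_GL_1)

lemma mult_sign_loop:
  assumes "a \<noteq> 0" "b \<noteq> 0"
  shows "(svec u, smat a) \<otimes>\<^bsub>sign_loop\<^esub> (svec v, smat b) =
      (svec (u + \<bar>a\<bar> * wt b / wt (a * b) * v), smat (a * b))"
  using assms by (simp add: L_Xi_def Xi_diff_smat inv_GL_smat field_simps)

lemma one_sign_loop: "\<one>\<^bsub>sign_loop\<^esub> = (svec 0, smat 1)"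
  by (simp add: L_Xi_def one_mat_smat zero_vec_svec)

text \<open>The matrix component forces b = m / a; the vector equation is then affine in the unknown
  with a nonzero slope. The equivalence gives existence and uniqueness together, hence both the loop
  axiom and the value of \<open>ldiv\<close>.\<close>

lemma ldiv_sign_loop_iff:
  assumes "a \<noteq> 0" "m \<noteq> 0"
  shows "x \<in> carrier sign_loop \<and> (svec u, smat a) \<otimes>\<^bsub>sign_loop\<^esub> x = (svec v, smat m) \<longleftrightarrow>
    x = (svec ((v - u) * wt m / (\<bar>a\<bar> * wt (m / a))), smat (m / a))"
proof -
  have "(\<exists>w b. x = (svec w, smat b) \<and> b \<noteq> 0 \<and> u + \<bar>a\<bar> * wt b / wt (a * b) * w = v \<and> a * b = m) \<longleftrightarrow>
    x = (svec ((v - u) * wt m / (\<bar>a\<bar> * wt (m / a))), smat (m / a))"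
  proof (intro iffI)
    assume "\<exists>w b. x = (svec w, smat b) \<and> b \<noteq> 0 \<and> u + \<bar>a\<bar> * wt b / wt (a * b) * w = v \<and> a * b = m"
    then show "x = (svec ((v - u) * wt m / (\<bar>a\<bar> * wt (m / a))), smat (m / a))"
      using assms by (auto simp: field_simps)
  next
    assume "x = (svec ((v - u) * wt m / (\<bar>a\<bar> * wt (m / a))), smat (m / a))"
    then show "\<exists>w b. x = (svec w, smat b) \<and> b \<noteq> 0 \<and> u + \<bar>a\<bar> * wt b / wt (a * b) * w = v \<and> a * b = m"
      using assms by (intro exI[of _ "(v - u) * wt m / (\<bar>a\<bar> * wt (m / a))"] exI[of _ "m / a"]) simp
  qed
  then show ?thesis using assms by (auto simp: carrier_sign_loop mult_sign_loop)
qed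

text \<open>Here the unknown vector entry has coefficient 1, so once a = m / b is known it is found
  by a subtraction.\<close>

lemma rdiv_sign_loop_iff:
  assumes "b \<noteq> 0" "m \<noteq> 0"
  shows "x \<in> carrier sign_loop \<and> x \<otimes>\<^bsub>sign_loop\<^esub> (svec u, smat b) = (svec v, smat m) \<longleftrightarrow>
    x = (svec (v - \<bar>m / b\<bar> * wt b / wt m * u), smat (m / b))"
proof -
  have "(\<exists>w a. x = (svec w, smat a) \<and> a \<noteq> 0 \<and> w + \<bar>a\<bar> * wt b / wt (a * b) * u = v \<and> a * b = m) \<longleftrightarrow>
    x = (svec (v - \<bar>m / b\<bar> * wt b / wt m * u), smat (m / b))"
    using assms by (auto simp: abs_mult)
  then show ?thesis using assms by (auto simp: carrier_sign_loop mult_sign_loop)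
qed

lemma ldiv_sign_loop:
  "a \<noteq> 0 \<Longrightarrow> m \<noteq> 0 \<Longrightarrow>
    ldiv sign_loop (svec u, smat a) (svec v, smat m) =
        (svec ((v - u) * wt m / (\<bar>a\<bar> * wt (m / a))), smat (m / a))"
  unfolding ldiv_def by (rule the_equality; use ldiv_sign_loop_iff in blast)

lemma rdiv_sign_loop:
  "b \<noteq> 0 \<Longrightarrow> m \<noteq> 0 \<Longrightarrow>
    rdiv sign_loop (svec v, smat m) (svec u, smat b) =
        (svec (v - \<bar>m / b\<bar> * wt b / wt m * u), smat (m / b))"
  unfolding rdiv_def by (rule the_equality; use rdiv_sign_loop_iff in blast)

lemma loop_sign_loop: "loop sign_loop"
proof
  show "\<one>\<^bsub>sign_loop\<^esub> \<in> carrier sign_loop" by (simp add: carrier_sign_loop one_sign_loop)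
next
  fix a b assume "a \<in> carrier sign_loop" "b \<in> carrier sign_loop"
  then obtain u a' v b' where "a = (svec u, smat a')" "b = (svec v, smat b')"
    and nz: "a' \<noteq> 0" "b' \<noteq> 0"
    by (auto simp: carrier_sign_loop)
  note eq = this(1,2)
  show "a \<otimes>\<^bsub>sign_loop\<^esub> b \<in> carrier sign_loop"
    unfolding eq mult_sign_loop[OF nz] using nz by (auto simp: carrier_sign_loop)
  show "\<exists>!x. x \<in> carrier sign_loop \<and> a \<otimes>\<^bsub>sign_loop\<^esub> x = b"
    unfolding eq ldiv_sign_loop_iff[OF nz] by simp
  show "\<exists>!x. x \<in> carrier sign_loop \<and> x \<otimes>\<^bsub>sign_loop\<^esub> a = b"
    unfolding eq rdiv_sign_loop_iff[OF nz] by simp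
next
  fix a assume "a \<in> carrier sign_loop"
  then obtain u a' where a: "a = (svec u, smat a')" "a' \<noteq> 0" by (auto simp: carrier_sign_loop)
  show "\<one>\<^bsub>sign_loop\<^esub> \<otimes>\<^bsub>sign_loop\<^esub> a = a" "a \<otimes>\<^bsub>sign_loop\<^esub> \<one>\<^bsub>sign_loop\<^esub> = a"
    using a by (simp_all add: one_sign_loop mult_sign_loop)
qed

lemma not_group_sign_loop: "\<not> group sign_loop"
proof
  assume "group sign_loop"
  then interpret group sign_loop .
  have [simp]: "wt 1 = 1" "wt (-1) = 3" by (simp_all add: wt_def)
  \<comment> \<open>The vector entry 1 of \<open>?y\<close> is scaled by wt 1 / wt (-1) = 1/3 in the
    left bracketing and by wt (-1) / wt 1 = 3 in the right one. The zero vector in \<open>?x\<close>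
    removes all other terms.\<close>
  let ?x = "(svec 0, smat (-1))" and ?y = "(svec 1, smat 1)"
  have "(?x \<otimes>\<^bsub>sign_loop\<^esub> ?y) \<otimes>\<^bsub>sign_loop\<^esub> ?x = ?x \<otimes>\<^bsub>sign_loop\<^esub> (?y \<otimes>\<^bsub>sign_loop\<^esub> ?x)"
    by (rule m_assoc) (simp_all add: carrier_sign_loop)
  then show False by (simp add: mult_sign_loop)
qed

section \<open>The manifold of the loop: disconnectedness and smoothness\<close>

abbreviation sign_loop_manifold :: "(real vec \<times> real mat) manifold" where
  "sign_loop_manifold \<equiv> prod_manifold (vec_manifold 1) (GL_manifold 1)"

lemmas global_chart_sign_loop_manifold = global_chart_prod[OF global_chart_vec global_chart_GL]

lemma topspace_sign_loop_manifold: "topspace (mtop sign_loop_manifold) = carrier sign_loop"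
  by (simp add: topspace_vec_1 topspace_GL_1 L_Xi_def)

text \<open>Coordinate 1 is the matrix entry. It maps the space continuously onto the reals without
  0, which is not an interval.\<close>

lemma not_connected_sign_loop_manifold: "\<not> connected_space (mtop sign_loop_manifold)"
proof
  assume c: "connected_space (mtop sign_loop_manifold)"
  let ?\<phi> = "prod_coords (mdim (vec_manifold 1)) (vec_coords 1) (mat_coords 1)"
  have "continuous_map (mtop sign_loop_manifold) (Euclidean_space 2) ?\<phi>"
    using global_chart_sign_loop_manifold
    by (auto simp: global_chart_def homeomorphic_maps_def continuous_map_in_subtopology)
  from continuous_map_compose[OF this continuous_map_Euclidean_space_component[of 2 1]]
  have "continuous_map (mtop sign_loop_manifold) euclideanreal (\<lambda>p. ?\<phi> p 1)" by (simp add: o_def)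
  then have con: "connected ((\<lambda>p. ?\<phi> p 1) ` carrier sign_loop)"
    using connectedin_continuous_map_image c by (metis connectedin_iff_connected
        connectedin_topspace topspace_sign_loop_manifold)
  have im: "(\<lambda>p. ?\<phi> p 1) ` carrier sign_loop = - {0}"
  proof -
    have "a \<in> (\<lambda>p. ?\<phi> p 1) ` carrier sign_loop" if "a \<noteq> 0" for a
      by (rule image_eqI[of _ _ "(svec 0, smat a)"])
        (use that in \<open>auto simp: carrier_sign_loop prod_coords_def mat_coords_smat\<close>)
    then show ?thesis by (auto simp: carrier_sign_loop prod_coords_def mat_coords_smat)
  qed
  have "(0::real) \<in> - {0}"
    by (rule connectedD_interval[OF con[unfolded im], of "-1" 1]) auto
  then show False by simp
qed

lemma wt_rational_sgn:
  "rational_sgn U f \<Longrightarrow> (\<And>x. x \<in> U \<Longrightarrow> f x \<noteq> 0) \<Longrightarrow> rational_sgn U (\<lambda>x. wt (f x))"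
  unfolding wt_def by (intro rational_sgn_intros) auto

lemma smooth_loop_sign_loop: "smooth_loop sign_loop sign_loop_manifold"
proof -
  note C = global_chart_sign_loop_manifold
  \<comment> \<open>In this chart, entries 0 and 1 are the vector and matrix entry of the first
    argument, entries 2 and 3 those of the second. The functions supplied below are the formulas for
    the product and the two quotients in these variables.\<close>
  note CC = global_chart_prod[OF C C]
  note simps = topspace_sign_loop_manifold carrier_sign_loop prod_coords_def mat_coords_smat
      vec_coords_svec
  have "smooth_map (prod_manifold sign_loop_manifold sign_loop_manifold) sign_loop_manifold
      (\<lambda>(a, b). a \<otimes>\<^bsub>sign_loop\<^esub> b)"
    by (rule global_chart_smooth_map[OF CC C, of _
          "\<lambda>i. if i = 0 then (\<lambda>x. x 0 + \<bar>x 1\<bar> * wt (x 3) / wt (x 1 * x 3) * x 2)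
               else (\<lambda>x. x 1 * x 3)"])
      \<comment> \<open>Only the outer product is split; the space of each factor has to stay folded
        to be rewritten to the carrier of the loop.\<close>
      (auto simp: topspace_prod_manifold[of sign_loop_manifold sign_loop_manifold] mult_sign_loop
          simps
        simp del: topspace_prod_manifold intro!: rational_sgn_intros wt_rational_sgn)
  moreover have "smooth_map (prod_manifold sign_loop_manifold sign_loop_manifold)
      sign_loop_manifold (\<lambda>(a, b). ldiv sign_loop a b)"
    by (rule global_chart_smooth_map[OF CC C, of _
          "\<lambda>i. if i = 0 then (\<lambda>x. (x 2 - x 0) * wt (x 3) / (\<bar>x 1\<bar> * wt (x 3 / x 1)))
               else (\<lambda>x. x 3 / x 1)"])
      (auto simp: topspace_prod_manifold[of sign_loop_manifold sign_loop_manifold] ldiv_sign_loop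
          simps
        simp del: topspace_prod_manifold intro!: rational_sgn_intros wt_rational_sgn)
  moreover have "smooth_map (prod_manifold sign_loop_manifold sign_loop_manifold)
      sign_loop_manifold (\<lambda>(b, a). rdiv sign_loop b a)"
    by (rule global_chart_smooth_map[OF CC C, of _
          "\<lambda>i. if i = 0 then (\<lambda>x. x 0 - \<bar>x 1 / x 3\<bar> * wt (x 3) / wt (x 1) * x 2)
               else (\<lambda>x. x 1 / x 3)"])
      (auto simp: topspace_prod_manifold[of sign_loop_manifold sign_loop_manifold] rdiv_sign_loop
          simps
        simp del: topspace_prod_manifold intro!: rational_sgn_intros wt_rational_sgn)
  ultimately show ?thesis
    using loop_sign_loop global_chart_smooth_manifold[OF C] topspace_sign_loop_manifold
    by (simp add: smooth_loop_def)
qed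

section \<open>The Akivis algebra\<close>

abbreviation aff_module :: "(real, real vec \<times> real mat) module" where
  "aff_module \<equiv> tangent_module 1 (carrier (GL 1))"

lemma carrier_aff: "carrier aff_module = {(svec x, smat m) | x m. True}"
  by (auto simp: tangent_module_def lie_algebra_of_GL_1 carrier_vec_1)

lemma aff_simps [simp]:
  "(svec x, smat m) \<oplus>\<^bsub>aff_module\<^esub> (svec y, smat k) = (svec (x + y), smat (m + k))"
  "c \<odot>\<^bsub>aff_module\<^esub> (svec x, smat m) = (svec (c * x), smat (c * m))"
  "\<zero>\<^bsub>aff_module\<^esub> = (svec 0, smat 0)"
  "(svec x, smat m) \<in> carrier aff_module"
  by (simp_all add: tangent_module_def zero_vec_svec zero_mat_smat lie_algebra_of_GL_1)

lemma ball_aff: "(\<forall>X\<in>carrier aff_module. P X) \<longleftrightarrow> (\<forall>x m. P (svec x, smat m))"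
  by (auto simp: carrier_aff)

lemma abelian_group_aff: "abelian_group aff_module"
proof (rule abelian_groupI)
  fix X assume "X \<in> carrier aff_module"
  then obtain x m where X: "X = (svec x, smat m)" by (auto simp: carrier_aff)
  show "\<exists>Y\<in>carrier aff_module. Y \<oplus>\<^bsub>aff_module\<^esub> X = \<zero>\<^bsub>aff_module\<^esub>"
    by (rule bexI[of _ "(svec (- x), smat (- m))"]) (simp_all add: X)
qed (auto simp: carrier_aff)

lemma minus_aff [simp]:
  "\<ominus>\<^bsub>aff_module\<^esub> (svec x, smat m) = (svec (- x), smat (- m))"
  "(svec x, smat m) \<ominus>\<^bsub>aff_module\<^esub> (svec y, smat k) = (svec (x - y), smat (m - k))"
proof -
  show "\<ominus>\<^bsub>aff_module\<^esub> (svec x, smat m) = (svec (- x), smat (- m))" for x m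
    by (rule abelian_group.minus_equality[OF abelian_group_aff]) simp_all
  then show "(svec x, smat m) \<ominus>\<^bsub>aff_module\<^esub> (svec y, smat k) = (svec (x - y), smat (m - k))"
    by (simp add: a_minus_def)
qed

lemma vectorspace_aff: "vectorspace class_ring aff_module"
proof (rule vectorspace.intro)
  show "field (class_ring :: real ring)" by (rule class_field.field_axioms)
  then show "Module.module class_ring aff_module"
    by (intro moduleI abelian_group_aff) (auto simp: carrier_aff algebra_simps field_def domain_def)
qed

text \<open>This is the Lie bracket of the affine group of the line: (x, m) stands for the 2 by 2
  matrix with first row (m, x) and second row 0.\<close>

definition aff_bracket :: "real vec \<times> real mat \<Rightarrow> real vec \<times> real mat \<Rightarrow> real vec \<times> real mat" where
  "aff_bracket X Y = (snd X *\<^sub>v fst Y - snd Y *\<^sub>v fst X, 0\<^sub>m 1 1)"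

lemma aff_bracket_smat [simp]: "aff_bracket (svec x, smat m) (svec y, smat k) =
    (svec (m * y - k * x), smat 0)"
  by (simp add: aff_bracket_def zero_mat_smat)

lemma jacobi_aff:
  "\<forall>x\<in>carrier aff_module. \<forall>y\<in>carrier aff_module. \<forall>z\<in>carrier aff_module. jacobi_side aff_module
      aff_bracket x y z = \<zero>\<^bsub>aff_module\<^esub>"
  by (simp add: ball_aff jacobi_side_def algebra_simps)

lemma module_hom_aff_iff:
  "f \<in> module_hom class_ring aff_module aff_module \<longleftrightarrow>
    (\<forall>X\<in>carrier aff_module. f X \<in> carrier aff_module) \<and>
    (\<forall>X\<in>carrier aff_module. \<forall>Y\<in>carrier aff_module. f (X \<oplus>\<^bsub>aff_module\<^esub> Y) = f X \<oplus>\<^bsub>aff_module\<^esub> f Y) \<and>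
    (\<forall>c. \<forall>X\<in>carrier aff_module. f (c \<odot>\<^bsub>aff_module\<^esub> X) = c \<odot>\<^bsub>aff_module\<^esub> f X)"
  by (auto simp: module_hom_def)

lemma lie_algebra_aff: "lie_algebra aff_module aff_bracket"
proof -
  have "bilinear_on aff_module aff_bracket"
    by (simp add: bilinear_on_def module_hom_aff_iff ball_aff algebra_simps)
  moreover have "skew_on aff_module aff_bracket"
    by (simp add: skew_on_def ball_aff)
  ultimately show ?thesis
    using vectorspace_aff jacobi_aff by (simp add: lie_algebra_def)
qed

lemma trilinear_zero: "trilinear_on aff_module (\<lambda>X Y Z. \<zero>\<^bsub>aff_module\<^esub>)"
  by (simp add: trilinear_on_def module_hom_aff_iff ball_aff)

section \<open>Commutators and associators along exponential curves\<close>

lemma exp_curve_smat: "exp_curve (svec x, smat m) t = (svec (t * x), smat (exp (t * m)))"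
  by (simp add: exp_curve_def mat_exp_smat)

text \<open>The quotients to be studied all have matrix part 1, because GL(1,R) is commutative and
  associative. The logarithm is then chosen constantly 0, and only the limit of the vector entry
  remains.\<close>

lemma coord_limitI:
  assumes "\<And>t. f t = (svec (y t), smat 1)" and "((\<lambda>t. y t / t ^ k) \<longlongrightarrow> z) (at 0)"
  shows "coord_limit 1 (carrier (GL 1)) k f (svec z, smat 0)"
  unfolding coord_limit_def
proof (intro conjI exI)
  show "\<forall>\<^sub>F t in at 0. svec (y t) \<in> carrier_vec 1 \<and> smat 0 \<in> lie_algebra_of 1 (carrier (GL 1)) \<and>
      f t = (svec (y t), mat_exp (smat 0))"
    using assms(1) by (intro always_eventually) (simp add: mat_exp_smat lie_algebra_of_GL_1)
qed (use assms(2) in \<open>auto simp: lie_algebra_of_GL_1\<close>)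

lemma wt_exp: "wt (exp t) = 1"
  by (simp add: wt_def)

text \<open>Exponentials are positive, so all weights equal 1 and the product is that of the affine
  group.\<close>

lemma mult_sign_loop_exp:
  "(svec u, smat (exp s)) \<otimes>\<^bsub>sign_loop\<^esub> (svec v, smat (exp t)) =
      (svec (u + exp s * v), smat (exp (s + t)))"
  by (simp add: mult_sign_loop wt_exp flip: exp_add)

lemma rdiv_sign_loop_exp: "rdiv sign_loop (svec v, smat (exp s)) (svec u, smat (exp s)) =
    (svec (v - u), smat 1)"
  by (simp add: rdiv_sign_loop)

lemma exp_minus_one_quotient: "((\<lambda>t. (exp (t * m) - 1) / t) \<longlongrightarrow> m) (at (0::real))"
proof -
  have "((\<lambda>t. exp (t * m)) has_real_derivative m) (at 0)"
    by (auto intro!: derivative_eq_intros)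
  then show ?thesis by (simp add: DERIV_def)
qed

lemma commutator_map_sign_loop: "commutator_map 1 (carrier (GL 1)) sign_loop aff_bracket"
  unfolding commutator_map_def ball_aff aff_bracket_smat
proof (intro allI coord_limitI)
  fix x m y k t
  show "rdiv sign_loop (exp_curve (svec x, smat m) t \<otimes>\<^bsub>sign_loop\<^esub> exp_curve (svec y, smat k) t)
      (exp_curve (svec y, smat k) t \<otimes>\<^bsub>sign_loop\<^esub> exp_curve (svec x, smat m) t) =
    (svec (t * ((exp (t * m) - 1) * y - (exp (t * k) - 1) * x)), smat 1)"
    \<comment> \<open>The two exponents are brought to the same form, since
      \<open>rdiv_sign_loop_exp\<close> asks for equal matrix entries.\<close>
    by (simp add: exp_curve_smat mult_sign_loop_exp add.commute[of "t * k"] rdiv_sign_loop_exp)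
        (simp add: algebra_simps)
next
  fix x m y k :: real
  have "((\<lambda>t. (exp (t * m) - 1) / t * y - (exp (t * k) - 1) / t * x) \<longlongrightarrow> m * y - k * x) (at 0)"
    by (intro tendsto_intros exp_minus_one_quotient)
  then show "((\<lambda>t. t * ((exp (t * m) - 1) * y - (exp (t * k) - 1) * x) / t\<^sup>2) \<longlongrightarrow> m * y - k * x)
      (at 0)"
    \<comment> \<open>For nonzero t the two expressions agree: one factor t of the square cancels
      the t from the vector entries, the other one forms the difference quotients of the
      exponentials.\<close>
    by (rule tendsto_cong[THEN iffD1, rotated])
      (auto simp: eventually_at_filter power2_eq_square field_simps)
qed

text \<open>On the identity component the two bracketings coincide exactly for every t, not merely
  to third order.\<close>

lemma associator_map_sign_loop: "associator_map 1 (carrier (GL 1)) sign_loop (\<lambda>X Y Z.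
    \<zero>\<^bsub>aff_module\<^esub>)"
  unfolding associator_map_def ball_aff aff_simps
proof (intro allI coord_limitI)
  fix x m y k z l t
  show "rdiv sign_loop
      (exp_curve (svec x, smat m) t \<otimes>\<^bsub>sign_loop\<^esub> exp_curve (svec y, smat k) t \<otimes>\<^bsub>sign_loop\<^esub>
          exp_curve (svec z, smat l) t)
      (exp_curve (svec x, smat m) t \<otimes>\<^bsub>sign_loop\<^esub> (exp_curve (svec y, smat k) t \<otimes>\<^bsub>sign_loop\<^esub>
          exp_curve (svec z, smat l) t)) =
    (svec 0, smat 1)"
    by (simp add: exp_curve_smat mult_sign_loop_exp rdiv_sign_loop_exp add.assoc)
      (simp add: algebra_simps exp_add)
qed simp

theorem mainTheorem6:
  shows "\<exists>(n :: nat) (\<Gamma> :: real mat set) (\<M> :: real mat manifold)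
           (\<delta> :: real mat \<Rightarrow> real mat) (A :: real mat) (B :: real mat).
    lie_subgroup_GL n \<Gamma> \<M> \<and> 0 < mdim \<M> \<and>
    \<delta> \<in> hom (GL n \<lparr>carrier := \<Gamma>\<rparr>) (GL n \<lparr>carrier := \<Gamma>\<rparr>) \<and> smooth_map \<M> \<M> \<delta> \<and>
    A \<in> carrier (GL n) \<and> B \<in> carrier (GL n) \<and>
    (\<forall>M\<in>\<Gamma>. \<not> eigenvalue (inv\<^bsub>GL n\<^esub> M * inv\<^bsub>GL n\<^esub> B * \<delta> M * A) 1) \<and>
    (let L = L_Xi n A B \<Gamma> \<delta>;
         N = prod_manifold (vec_manifold n) \<M>;
         V = tangent_module n \<Gamma>
     in proper_loop L \<and> smooth_loop L N \<and> 0 < mdim N \<and> \<not> connected_space (mtop N) \<and>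
        (\<exists>br asc.
           commutator_map n \<Gamma> L br \<and> associator_map n \<Gamma> L asc \<and>
           akivis_algebra V br asc \<and>
           (\<forall>x\<in>carrier V. \<forall>y\<in>carrier V. \<forall>z\<in>carrier V.
              jacobi_side V br x y z = \<zero>\<^bsub>V\<^esub> \<and> associator_side V asc x y z = \<zero>\<^bsub>V\<^esub>) \<and>
           lie_algebra V br))"
proof -
  have hom: "abs_entry \<in> hom (GL 1\<lparr>carrier := carrier (GL 1)\<rparr>) (GL 1\<lparr>carrier := carrier (GL 1)\<rparr>)"
    by (auto simp: hom_def carrier_GL_1 abs_mult)
  have smooth: "smooth_map (GL_manifold 1) (GL_manifold 1) abs_entry"
    by (rule global_chart_smooth_map[OF global_chart_GL global_chart_GL, of _ "\<lambda>i x. \<bar>x 0\<bar>"])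
      (auto simp: topspace_GL_1 carrier_GL_1 mat_coords_smat intro!: rational_sgn_intros)
  have ev: "\<not> eigenvalue (inv\<^bsub>GL 1\<^esub> M * inv\<^bsub>GL 1\<^esub> (smat 2) * abs_entry M * smat 1) 1"
    if "M \<in> carrier (GL 1)" for M
  proof -
    obtain a where M: "M = smat a" "a \<noteq> 0" using \<open>M \<in> carrier (GL 1)\<close> by (auto simp: carrier_GL_1)
    \<comment> \<open>The entry is (1/a) (1/2) |a|, which is 1/2 or -1/2 and never 1.\<close>
    have "inv\<^bsub>GL 1\<^esub> M * inv\<^bsub>GL 1\<^esub> (smat 2) * abs_entry M * smat 1 = smat (sgn a / 2)"
      using M by (simp add: inv_GL_smat sgn_if field_simps)
    moreover have "\<not> eigenvalue (smat c) 1" if "c \<noteq> 1" for c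
      using that by (auto simp: eigenvalue_def eigenvector_def carrier_vec_1 zero_vec_svec)
    ultimately show ?thesis by (simp add: sgn_if)
  qed
  have asc: "associator_side aff_module (\<lambda>X Y Z. \<zero>\<^bsub>aff_module\<^esub>) x y z = \<zero>\<^bsub>aff_module\<^esub>" for x y z
    by (simp add: associator_side_def)
  have ak: "akivis_algebra aff_module aff_bracket (\<lambda>X Y Z. \<zero>\<^bsub>aff_module\<^esub>)"
    \<comment> \<open>The Akivis identity reads 0 = 0: the left side vanishes by the Jacobi
      identity, the right side because the associator map is zero.\<close>
    using lie_algebra_aff trilinear_zero asc by (simp add: akivis_algebra_def lie_algebra_def)
  show ?thesis
    unfolding Let_def
    by (intro exI[of _ 1] exI[of _ "carrier (GL 1)"] exI[of _ "GL_manifold 1"] exI[of _ abs_entry]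
        exI[of _ "smat 1"] exI[of _ "smat 2"] exI[of _ aff_bracket] exI[of _ "\<lambda>X Y Z.
            \<zero>\<^bsub>aff_module\<^esub>"] conjI)
      \<comment> \<open>The zero of the tangent module is kept folded, so that the goals match the
        facts in the form in which they were proved.\<close>
      (use lie_subgroup_GL_1 hom smooth ev loop_sign_loop not_group_sign_loop
          smooth_loop_sign_loop not_connected_sign_loop_manifold
         commutator_map_sign_loop associator_map_sign_loop ak jacobi_aff asc lie_algebra_aff
       in \<open>auto simp: proper_loop_def simp del: aff_simps(3)\<close>)
qed

end
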